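(* Let $\langle I_n:n<\omega\rangle$ be deterministic ideals on $\omega$ and let $I$ be the ideal generated by $\bigcup_{n<\omega}I_n$ (i.e. the sets contained in a finite union of members of the $I_n$'s), assumed to be a proper ideal. Then $I$ is deterministic.
   Context: For an ideal $J$ on $\omega$, $J^*=\{\omega\setminus A:A\in J\}$. $J$ is deterministic if there is a cofinal set $\mathcal{B}\subseteq J$ (under inclusion) such that for every $\mathcal{A}\subseteq\mathcal{B}$, either $\bigcup\mathcal{A}\in J$ or $\bigcup\mathcal{A}\in J^*$. *)

theory Defs imports Main
begin

text \<open>As usual for ideals on \<open>\<omega>\<close> (here \<open>\<omega>\<close> is the type \<^typ>\<open>nat\<close>), an ideal is proper and
  contains every finite set.\<close>

definition ideal_on_omega :: "nat set set \<Rightarrow> bool" where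
  "ideal_on_omega J \<longleftrightarrow>
     (\<forall>A. finite A \<longrightarrow> A \<in> J) \<and>
     (\<forall>A\<in>J. \<forall>B. B \<subseteq> A \<longrightarrow> B \<in> J) \<and>
     (\<forall>A\<in>J. \<forall>B\<in>J. A \<union> B \<in> J) \<and>
     UNIV \<notin> J"

definition dual_filter :: "nat set set \<Rightarrow> nat set set" where
  "dual_filter J = {UNIV - A | A. A \<in> J}"

definition cofinal_in :: "nat set set \<Rightarrow> nat set set \<Rightarrow> bool" where
  "cofinal_in \<B> J \<longleftrightarrow> \<B> \<subseteq> J \<and> (\<forall>A\<in>J. \<exists>B\<in>\<B>. A \<subseteq> B)"

definition deterministic :: "nat set set \<Rightarrow> bool" where
  "deterministic J \<longleftrightarrow> ideal_on_omega J \<and>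
     (\<exists>\<B>. cofinal_in \<B> J \<and> (\<forall>\<A>. \<A> \<subseteq> \<B> \<longrightarrow> \<Union>\<A> \<in> J \<or> \<Union>\<A> \<in> dual_filter J))"

text \<open>The result need not be proper.\<close>

definition generated_ideal :: "nat set set \<Rightarrow> nat set set" where
  "generated_ideal \<S> = {A. \<exists>\<F>. finite \<F> \<and> \<F> \<subseteq> \<S> \<and> A \<subseteq> \<Union>\<F>}"

end

theory Submission imports Defs
begin

text \<open>If \<open>\<B> n\<close> witnesses that \<open>I n\<close> is deterministic, then the sets
  \<open>b 0 \<union> \<dots> \<union> b n \<union> {0, \<dots>, n}\<close> with \<open>b i \<in> \<B> i\<close> witness that the generated ideal is. The initial
  segments make every subfamily with unbounded \<open>n\<close> cover \<open>\<omega>\<close>, and a subfamily with bounded \<open>n\<close>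
  involves only finitely many of the ideals, so that determinacy applies to each of them in turn.\<close>

lemma in_dual_filter_iff: "X \<in> dual_filter J \<longleftrightarrow> - X \<in> J"
proof -
  have "X = UNIV - A \<longleftrightarrow> A = - X" for A by auto
  then show ?thesis unfolding dual_filter_def by simp
qed

lemma generated_ideal_superset: "A \<in> \<S> \<Longrightarrow> A \<in> generated_ideal \<S>"
  unfolding generated_ideal_def by (auto intro!: exI[of _ "{A}"])

lemma generated_ideal_subset: "A \<in> generated_ideal \<S> \<Longrightarrow> B \<subseteq> A \<Longrightarrow> B \<in> generated_ideal \<S>"
  unfolding generated_ideal_def by blast

text \<open>Choosing for each member of \<open>\<F>\<close> a finite cover from \<open>\<S>\<close>
  and collecting all these covers gives a finite cover of \<open>\<Union>\<F>\<close>. Arbitrary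
  finite families are allowed so that unions over \<open>i \<le> n\<close> are handled without
  induction.\<close>

lemma generated_ideal_Union:
  assumes "finite \<F>" "\<F> \<subseteq> generated_ideal \<S>"
  shows "\<Union>\<F> \<in> generated_ideal \<S>"
proof -
  from assms(2) have "\<forall>A\<in>\<F>. \<exists>\<G>. finite \<G> \<and> \<G> \<subseteq> \<S> \<and> A \<subseteq> \<Union>\<G>"
    unfolding generated_ideal_def by blast
  then obtain g where g: "\<forall>A\<in>\<F>. finite (g A) \<and> g A \<subseteq> \<S> \<and> A \<subseteq> \<Union>(g A)"
    by metis
  have "finite (\<Union>(g ` \<F>))"
    using g assms(1) by blast
  moreover have "\<Union>(g ` \<F>) \<subseteq> \<S>"
    using g by blast
  moreover have "\<Union>\<F> \<subseteq> \<Union>(\<Union>(g ` \<F>))"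
  proof (rule Union_least)
    fix A assume "A \<in> \<F>"
    then have "A \<subseteq> \<Union>(g A)" "g A \<subseteq> \<Union>(g ` \<F>)" using g by auto
    then show "A \<subseteq> \<Union>(\<Union>(g ` \<F>))" by (meson Union_mono order_trans)
  qed
  ultimately show ?thesis unfolding generated_ideal_def by blast
qed

lemma generated_ideal_Un:
  "A \<in> generated_ideal \<S> \<Longrightarrow> B \<in> generated_ideal \<S> \<Longrightarrow> A \<union> B \<in> generated_ideal \<S>"
  using generated_ideal_Union[of "{A, B}" \<S>] by simp

lemma ideal_generated_ideal:
  assumes "\<And>A. finite A \<Longrightarrow> A \<in> \<S>" "UNIV \<notin> generated_ideal \<S>"
  shows "ideal_on_omega (generated_ideal \<S>)"
  unfolding ideal_on_omega_def
  using assms by (auto intro: generated_ideal_superset generated_ideal_subset generated_ideal_Un)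

theorem theorem3p28:
  fixes I :: "nat \<Rightarrow> nat set set"
  assumes "\<And>n. deterministic (I n)"
    and "UNIV \<notin> generated_ideal (\<Union>n. I n)"
  shows "deterministic (generated_ideal (\<Union>n. I n))"
proof -
  define G where "G = generated_ideal (\<Union>n. I n)"
  have "\<forall>n. \<exists>\<B>. cofinal_in \<B> (I n) \<and> (\<forall>\<A>. \<A> \<subseteq> \<B> \<longrightarrow> \<Union>\<A> \<in> I n \<or> \<Union>\<A> \<in> dual_filter (I n))"
    using assms(1) unfolding deterministic_def by blast
  from choice[OF this] obtain \<B> where \<B>: "\<forall>n. cofinal_in (\<B> n) (I n) \<and>
      (\<forall>\<A>. \<A> \<subseteq> \<B> n \<longrightarrow> \<Union>\<A> \<in> I n \<or> \<Union>\<A> \<in> dual_filter (I n))" ..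
  have cof: "cofinal_in (\<B> n) (I n)" for n
    using \<B> by simp
  have det: "\<Union>\<A> \<in> I n \<or> \<Union>\<A> \<in> dual_filter (I n)" if "\<A> \<subseteq> \<B> n" for n \<A>
    using \<B> that by simp
  have idI: "ideal_on_omega (I n)" for n
    using assms(1)[of n] unfolding deterministic_def by simp
  have fin: "A \<in> I n" if "finite A" for A n
    using idI[of n] that unfolding ideal_on_omega_def by simp
  have un: "A \<union> B \<in> I n" if "A \<in> I n" "B \<in> I n" for A B n
    using idI[of n] that unfolding ideal_on_omega_def by simp
  have IG: "A \<in> G" if "A \<in> I n" for A n
    using that unfolding G_def by (blast intro: generated_ideal_superset)
  have sub: "B \<in> G" if "A \<in> G" "B \<subseteq> A" for A B
    using that unfolding G_def by (rule generated_ideal_subset)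
  have unG: "A \<union> B \<in> G" if "A \<in> G" "B \<in> G" for A B
    using that unfolding G_def by (rule generated_ideal_Un)
  have UnG: "(\<Union>i\<le>n. f i) \<in> G" if "\<And>i. f i \<in> G" for f and n :: nat
    using that unfolding G_def by (intro generated_ideal_Union) auto
  have idG: "ideal_on_omega G"
    unfolding G_def using assms(2) fin by (intro ideal_generated_ideal) blast+
  define U where "U n b = (\<Union>i\<le>n. b i) \<union> {..n}" for n and b :: "nat \<Rightarrow> nat set"
  \<comment> \<open>\<open>U n b\<close> reads only \<open>b 0\<close>, ..., \<open>b n\<close>. Any
    such finite choice extends to a full sequence, since cofinality makes every
    \<open>\<B> i\<close> nonempty.\<close>
  define \<D> where "\<D> = {U n b | n b. \<forall>i. b i \<in> \<B> i}"
  have UG: "U n b \<in> G" if "\<forall>i. b i \<in> \<B> i" for n b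
    unfolding U_def
  proof (intro unG UnG)
    show "b i \<in> G" for i
      using that cof[of i] IG unfolding cofinal_in_def by blast
    show "{..n} \<in> G" using fin IG by blast
  qed
  have "\<exists>D\<in>\<D>. A \<subseteq> D" if "A \<in> G" for A
  proof -
    from that obtain \<F> where \<F>: "finite \<F>" "\<F> \<subseteq> (\<Union>n. I n)" "A \<subseteq> \<Union>\<F>"
      unfolding G_def generated_ideal_def by blast
    obtain k where k: "\<And>F. F \<in> \<F> \<Longrightarrow> F \<in> I (k F)"
      using \<F>(2) by (metis UN_E subsetD)
    \<comment> \<open>The finite cover is grouped by the index \<open>k F\<close> of an ideal
      containing \<open>F\<close>: each group has its union in a single \<open>I i\<close>, where
      cofinality of \<open>\<B> i\<close> applies. Empty groups are harmless.\<close>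
    have "\<exists>b\<in>\<B> i. \<Union>{F\<in>\<F>. k F = i} \<subseteq> b" for i
    proof -
      have "\<Union>\<F>' \<in> I i" if "finite \<F>'" "\<F>' \<subseteq> I i" for \<F>'
        using that by (induction \<F>' rule: finite_induct) (auto intro: fin un)
      from this[of "{F\<in>\<F>. k F = i}"] have "\<Union>{F\<in>\<F>. k F = i} \<in> I i"
        using \<F>(1) k by auto
      then show ?thesis using cof[of i] unfolding cofinal_in_def by blast
    qed
    then obtain b where b: "\<And>i. b i \<in> \<B> i" "\<And>i. \<Union>{F\<in>\<F>. k F = i} \<subseteq> b i"
      by metis
    obtain n where n: "\<And>F. F \<in> \<F> \<Longrightarrow> k F \<le> n"
      using \<F>(1) finite_nat_set_iff_bounded_le[of "k ` \<F>"] by auto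
    have "A \<subseteq> U n b"
    proof
      fix x assume "x \<in> A"
      then obtain F where F: "F \<in> \<F>" "x \<in> F" using \<F>(3) by blast
      then have "x \<in> b (k F)" using b(2)[of "k F"] by blast
      then show "x \<in> U n b" unfolding U_def using n[OF F(1)] by blast
    qed
    then show ?thesis unfolding \<D>_def using b(1) by blast
  qed
  then have "cofinal_in \<D> G"
    unfolding cofinal_in_def using UG by (auto simp: \<D>_def)
  moreover have "\<Union>\<A> \<in> G \<or> \<Union>\<A> \<in> dual_filter G" if "\<A> \<subseteq> \<D>" for \<A>
  proof -
    \<comment> \<open>A set in \<open>\<A>\<close> does not determine \<open>n\<close> and
      \<open>b\<close>, so all its representations are kept. The case split is on whether
      \<open>n\<close> is bounded over them.\<close>
    define P where "P = {(n, b). (\<forall>i. b i \<in> \<B> i) \<and> U n b \<in> \<A>}"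
    have UP: "\<Union>\<A> = (\<Union>(n, b)\<in>P. U n b)"
      using that unfolding P_def \<D>_def by blast
    show ?thesis
    proof (cases "\<exists>N. \<forall>(n, b)\<in>P. n \<le> N")
      case True
      then obtain N where N: "\<And>n b. (n, b) \<in> P \<Longrightarrow> n \<le> N" by blast
      \<comment> \<open>The restriction \<open>i \<le> n\<close> ensures that \<open>b i\<close> is
        really a part of \<open>U n b\<close>, hence of \<open>\<Union>\<A>\<close>.\<close>
      define V where "V i = {b i | n b. (n, b) \<in> P \<and> i \<le> n}" for i
      have V: "V i \<subseteq> \<B> i" for i
        unfolding V_def P_def by blast
      have VA: "\<Union>(V i) \<subseteq> \<Union>\<A>" for i
        unfolding V_def UP U_def by blast
      show ?thesis
      proof (cases "\<exists>i. \<Union>(V i) \<in> dual_filter (I i)")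
        case True
        then obtain i where "- \<Union>(V i) \<in> I i"
          unfolding in_dual_filter_iff by blast
        \<comment> \<open>One co-small \<open>\<Union>(V i)\<close> suffices:
          \<open>\<Union>\<A>\<close> contains it, so its complement is even smaller.\<close>
        then have "- \<Union>\<A> \<in> G"
          using IG sub VA[of i] by (meson Compl_anti_mono)
        then show ?thesis unfolding in_dual_filter_iff by blast
      next
        case False
        \<comment> \<open>Determinacy of each \<open>I i\<close> now leaves only
          \<open>\<Union>(V i) \<in> I i\<close>. By the bound \<open>N\<close>, finitely many of
          these sets and one initial segment cover \<open>\<Union>\<A>\<close>.\<close>
        then have "\<Union>(V i) \<in> G" for i
          using det[OF V] IG by blast
        then have "(\<Union>i\<le>N. \<Union>(V i)) \<union> {..N} \<in> G"
          using fin IG by (intro unG UnG) blast+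
        moreover have "\<Union>\<A> \<subseteq> (\<Union>i\<le>N. \<Union>(V i)) \<union> {..N}"
        proof
          fix x assume "x \<in> \<Union>\<A>"
          then obtain n b where nb: "(n, b) \<in> P" "x \<in> U n b" unfolding UP by blast
          show "x \<in> (\<Union>i\<le>N. \<Union>(V i)) \<union> {..N}"
            using nb N[OF nb(1)] unfolding U_def V_def by fastforce
        qed
        ultimately show ?thesis using sub by blast
      qed
    next
      case False
      have "x \<in> \<Union>\<A>" for x
      proof -
        \<comment> \<open>Unboundedness gives a pair whose initial segment \<open>{..n}\<close>
          already contains \<open>x\<close>.\<close>
        obtain n b where "(n, b) \<in> P" "x < n"
          using False by (force simp: not_le)
        then have "x \<in> U n b" unfolding U_def by simp
        then show ?thesis unfolding UP using \<open>(n, b) \<in> P\<close> by blast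
      qed
      then have "- \<Union>\<A> = {}" by blast
      then show ?thesis
        unfolding in_dual_filter_iff using fin IG by (metis finite.emptyI)
    qed
  qed
  ultimately show ?thesis
    using idG unfolding deterministic_def G_def by blast
qed

end
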